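(* Any first-order stationary point of (OCP) is a first-order stationary point of (CDF). On the other hand, any first-order stationary point of (CDF) lying in $\mathcal{M}$ is a first-order stationary point of (OCP).
   Context: Let $f:\mathbb{R}^n\to\mathbb{R}$, $c:\mathbb{R}^n\to\mathbb{R}^p$ be differentiable, $\mathcal{M}=\{x\in\mathbb{R}^n: c(x)=0\}$, and consider the problem (OCP): minimize $f(x)$ subject to $c(x)=0$. $J_c(x)\in\mathbb{R}^{n\times p}$ is the transposed Jacobian of $c$ (entry $(i,j)$ is $\partial c_j/\partial x_i$). Assumed: $\nabla f$ and $J_c$ are locally Lipschitz continuous on $\mathbb{R}^n$, and $J_c(x)$ has full column rank for every $x\in\mathcal{M}$. Let $\mathcal{A}:\mathbb{R}^n\to\mathbb{R}^n$ be differentiable with transposed Jacobian $J_{\mathcal{A}}(x)\in\mathbb{R}^{n\times n}$ (entry $(i,j)$ is $\partial\mathcal{A}_j/\partial x_i$), such that $J_{\mathcal{A}}$ is locally Lipschitz continuous on $\mathbb{R}^n$, $\mathcal{A}(x)=x$ for $x\in\mathcal{M}$, and $J_{\mathcal{A}}(x)J_c(x)=0$ for $x\in\mathcal{M}$. For a penalty parameter $\beta>0$ put $h(x)=f(\mathcal{A}(x))+\frac{\beta}{2}\|c(x)\|^2$ ($\ell_2$-norm); (CDF) is the problem of minimizing $h$ over $\mathbb{R}^n$. $x\in\mathbb{R}^n$ is a first-order stationary point of (OCP) if $c(x)=0$ and $\nabla f(x)=\sum_{i=1}^p\tilde\lambda_i\nabla c_i(x)$ for some $\tilde\lambda\in\mathbb{R}^p$.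 $x\in\mathbb{R}^n$ is a first-order stationary point of (CDF) if $\nabla h(x)=0$. *)

theory Defs
  imports "HOL-Analysis.Analysis"
begin

(* Vector of partial derivatives. Where f is not differentiable, frechet_derivative, and hence
   grad f x, is an unspecified value; grad is meant for differentiable f. *)
definition grad :: "(real ^ 'n \<Rightarrow> real) \<Rightarrow> real ^ 'n \<Rightarrow> real ^ 'n" where
  "grad f x = (\<chi> i. frechet_derivative f (at x) (axis i 1))"

(* The library's jacobian has entry (j, i) equal to the partial derivative of the j-th component
   in direction i; here rows are indexed by the variables and columns by the components. *)
definition tjacobian :: "(real ^ 'n \<Rightarrow> real ^ 'p) \<Rightarrow> real ^ 'n \<Rightarrow> real ^ 'p ^ 'n" where
  "tjacobian c x = transpose (jacobian c (at x))"

(* For matrix-valued F the metric is that of the Frobenius norm. *)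
definition locally_lipschitz :: "('a::metric_space \<Rightarrow> 'b::metric_space) \<Rightarrow> bool" where
  "locally_lipschitz F \<longleftrightarrow> (\<forall>x. \<exists>r>0. \<exists>L. L-lipschitz_on (ball x r) F)"

definition feasible_set :: "(real ^ 'n \<Rightarrow> real ^ 'p) \<Rightarrow> (real ^ 'n) set" where
  "feasible_set c = {x. c x = 0}"

definition cdf_objective ::
  "real \<Rightarrow> (real ^ 'n \<Rightarrow> real) \<Rightarrow> (real ^ 'n \<Rightarrow> real ^ 'p) \<Rightarrow> (real ^ 'n \<Rightarrow> real ^ 'n) \<Rightarrow> real ^ 'n \<Rightarrow> real"
where
  "cdf_objective \<beta> f c A x = f (A x) + \<beta> / 2 * (norm (c x))\<^sup>2"

definition ocp_stationary ::
  "(real ^ 'n \<Rightarrow> real) \<Rightarrow> (real ^ 'n \<Rightarrow> real ^ 'p) \<Rightarrow> real ^ 'n \<Rightarrow> bool"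
where
  "ocp_stationary f c x \<longleftrightarrow>
     c x = 0 \<and> (\<exists>l :: real ^ 'p. grad f x = (\<Sum>i\<in>UNIV. (l $ i) *\<^sub>R grad (\<lambda>y. c y $ i) x))"

definition cdf_stationary ::
  "real \<Rightarrow> (real ^ 'n \<Rightarrow> real) \<Rightarrow> (real ^ 'n \<Rightarrow> real ^ 'p) \<Rightarrow> (real ^ 'n \<Rightarrow> real ^ 'n) \<Rightarrow> real ^ 'n \<Rightarrow> bool"
where
  "cdf_stationary \<beta> f c A x \<longleftrightarrow> grad (cdf_objective \<beta> f c A) x = 0"

lemma grad_eq_gderiv: "GDERIV f x :> v \<Longrightarrow> grad f x = v"
  unfolding gderiv_def grad_def
  by (drule frechet_derivative_at, drule sym) (simp add: vec_eq_iff inner_axis')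

lemma tjacobian_nth:
  assumes "c differentiable (at x)"
  shows "tjacobian c x $ i $ j = grad (\<lambda>y. c y $ j) x $ i"
proof -
  have "(c has_derivative frechet_derivative c (at x)) (at x)"
    using assms frechet_derivative_works by blast
  then have "((\<lambda>y. c y $ j) has_derivative (\<lambda>h. frechet_derivative c (at x) h $ j)) (at x)"
    by (rule bounded_linear.has_derivative[OF bounded_linear_vec_nth])
  then show ?thesis
    by (simp add: tjacobian_def grad_def transpose_def jacobian_def matrix_def
        frechet_derivative_at[symmetric])
qed

end

theory Submission
  imports Defs
begin

text \<open>
  At a feasible point \<open>x\<close> the quadratic penalty has derivative zero and \<open>A x = x\<close>, so
  \<open>h'(x) d = f'(x) (A'(x) d)\<close>: stationarity for (CDF) says that \<open>f'(x)\<close> vanishes on the range of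
  \<open>A'(x)\<close>. The hypothesis on \<open>J\<^sub>A J\<^sub>c\<close> says, after transposition, that this range lies in
  \<open>ker c'(x)\<close>; and a multiplier for (OCP) exists exactly when \<open>f'(x)\<close> vanishes on \<open>ker c'(x)\<close>,
  because the range of a matrix is the orthogonal complement of the kernel of its transpose.
  Hence everything reduces to showing that \<open>A'(x)\<close> maps onto \<open>ker c'(x)\<close>; in fact it is the
  identity there.

  For this, each \<open>d\<close> in \<open>ker c'(x)\<close> is realised as the velocity of a curve inside the feasible set
  (lemma \<open>tangent_curve_in_zero_set\<close>, where full rank enters). Since \<open>A\<close> fixes the curve pointwise,
  the chain rule and uniqueness of derivatives give \<open>A'(x) d = d\<close>. The curve comes from Brouwer's
  fixed point theorem, which corrects the line \<open>x + t d\<close> to a point of the feasible set by a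
  displacement of order \<open>o(t)\<close> (lemma \<open>zero_near_tangent_line\<close>).
\<close>

section \<open>Tangent directions of a zero set\<close>

text \<open>
  With a right inverse \<open>g\<close> of \<open>c'\<close>, the map \<open>u \<mapsto> u - c (x + t d + g u)\<close> is the error of the linear
  approximation of \<open>c\<close>, which is small compared with \<open>\<bar>t\<bar>\<close> when \<open>u\<close> is at most of order \<open>\<bar>t\<bar>\<close>. It thus
  maps a ball of radius \<open>r \<bar>t\<bar>\<close> to itself, and its fixed points are zeros of \<open>c\<close>.
\<close>

lemma zero_near_tangent_line:
  fixes c :: "'a::euclidean_space \<Rightarrow> 'b::euclidean_space"
  assumes cont: "continuous_on UNIV c"
    and der: "(c has_derivative c') (at x)"
    and surj: "surj c'"
    and zero: "c x = 0"
    and tangent: "c' d = 0"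
    and "e > 0"
  shows "\<exists>\<delta>>0. \<forall>t. \<bar>t\<bar> < \<delta> \<longrightarrow> (\<exists>y. c y = 0 \<and> norm (y - (x + t *\<^sub>R d)) \<le> e * \<bar>t\<bar>)"
proof -
  have lin: "linear c'"
    using der has_derivative_linear by blast
  obtain g where "linear g" and cg: "c' \<circ> g = id"
    using linear_surjective_right_inverse[OF lin surj] by blast
  then have g: "bounded_linear g"
    by (simp add: linear_conv_bounded_linear)
  obtain K where "K > 0" and K: "\<And>u. norm (g u) \<le> norm u * K"
    using bounded_linear.pos_bounded[OF g] by blast
  \<comment> \<open>\<open>r\<close> makes the correction \<open>g u\<close> at most \<open>e \<bar>t\<bar>\<close>; \<open>L \<bar>t\<bar>\<close> bounds the total displacement
    \<open>t d + g u\<close>; \<open>\<eta>\<close> makes the linearisation error at most \<open>r \<bar>t\<bar>\<close>.\<close>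
  define r where "r = e / K"
  define L where "L = norm d + e + 1"
  define \<eta> where "\<eta> = r / L"
  have pos: "r > 0" "L > 0" "\<eta> > 0"
    using \<open>e > 0\<close> \<open>K > 0\<close> by (auto simp: r_def L_def \<eta>_def add_nonneg_pos)
  obtain \<delta>\<^sub>0 where "\<delta>\<^sub>0 > 0"
    and approx: "\<And>y. norm (y - x) < \<delta>\<^sub>0 \<Longrightarrow> norm (c y - c x - c' (y - x)) \<le> \<eta> * norm (y - x)"
    using der \<open>\<eta> > 0\<close> unfolding has_derivative_at_alt by blast
  show ?thesis
  proof (intro exI[of _ "\<delta>\<^sub>0 / L"] conjI allI impI)
    show "\<delta>\<^sub>0 / L > 0"
      using \<open>\<delta>\<^sub>0 > 0\<close> pos by simp
    fix t :: real
    assume t: "\<bar>t\<bar> < \<delta>\<^sub>0 / L"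
    define \<phi> where "\<phi> u = u - c (x + t *\<^sub>R d + g u)" for u
    define B where "B = cball (0::'b) (r * \<bar>t\<bar>)"
    have correction: "norm (g u) \<le> e * \<bar>t\<bar>" if "u \<in> B" for u
    proof -
      have "norm (g u) \<le> (r * \<bar>t\<bar>) * K"
        using that \<open>K > 0\<close> by (intro order_trans[OF K] mult_right_mono) (auto simp: B_def)
      then show ?thesis
        using \<open>K > 0\<close> by (simp add: r_def)
    qed
    have self_map: "\<phi> u \<in> B" if "u \<in> B" for u
    proof -
      let ?v = "t *\<^sub>R d + g u"
      have "norm ?v \<le> \<bar>t\<bar> * norm d + e * \<bar>t\<bar>"
        using norm_triangle_ineq[of "t *\<^sub>R d" "g u"] correction[OF that] by simp
      also have "\<dots> \<le> L * \<bar>t\<bar>"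
        by (simp add: L_def algebra_simps)
      finally have v: "norm ?v \<le> L * \<bar>t\<bar>" .
      also have "L * \<bar>t\<bar> < \<delta>\<^sub>0"
        using t \<open>L > 0\<close> by (simp add: field_simps)
      finally have "norm (c (x + ?v) - c x - c' ?v) \<le> \<eta> * norm ?v"
        using approx[of "x + ?v"] by simp
      moreover have "c' ?v = u"
        using cg by (simp add: linear_add[OF lin] linear_scale[OF lin] tangent pointfree_idE)
      ultimately have "norm (\<phi> u) \<le> \<eta> * norm ?v"
        by (simp add: \<phi>_def zero norm_minus_commute add.assoc)
      also have "\<dots> \<le> \<eta> * (L * \<bar>t\<bar>)"
        using v pos by (intro mult_left_mono) auto
      also have "\<dots> = r * \<bar>t\<bar>"
        using pos by (simp add: \<eta>_def)
      finally show ?thesis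
        by (simp add: B_def)
    qed
    have "continuous_on B g"
      using g linear_continuous_on by blast
    then have "continuous_on B \<phi>"
      unfolding \<phi>_def
      by (intro continuous_intros continuous_on_compose2[OF cont]) auto
    moreover have "compact B" "convex B" "B \<noteq> {}"
      using pos by (auto simp: B_def not_less)
    ultimately obtain u where "u \<in> B" "\<phi> u = u"
      using brouwer[of B \<phi>] self_map by (metis image_subsetI Pi_I)
    then have "c (x + t *\<^sub>R d + g u) = 0"
      by (simp add: \<phi>_def)
    with correction[OF \<open>u \<in> B\<close>] show "\<exists>y. c y = 0 \<and> norm (y - (x + t *\<^sub>R d)) \<le> e * \<bar>t\<bar>"
      by (intro exI[of _ "x + t *\<^sub>R d + g u"]) simp
  qed
qed

text \<open>
  The zeros supplied by the previous lemma depend on \<open>e\<close>. Projecting the line \<open>x + t d\<close> to a nearest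
  point of the closed zero set gives a single curve that is at least as close as all of them.
\<close>

lemma tangent_curve_in_zero_set:
  fixes c :: "'a::euclidean_space \<Rightarrow> 'b::euclidean_space"
  assumes cont: "continuous_on UNIV c"
    and "(c has_derivative c') (at x)" and "surj c'" and zero: "c x = 0" and "c' d = 0"
  obtains \<gamma> where "\<gamma> 0 = x" and "(\<gamma> has_vector_derivative d) (at 0)" and "\<And>t::real. c (\<gamma> t) = 0"
proof
  let ?M = "{y. c y = 0}"
  define \<gamma> where "\<gamma> t = closest_point ?M (x + t *\<^sub>R d)" for t
  have closed: "closed ?M"
    using cont by (intro closed_Collect_eq) auto
  show start: "\<gamma> 0 = x"
    using zero by (simp add: \<gamma>_def closest_point_self)
  show "c (\<gamma> t) = 0" for t
    using closest_point_in_set[OF closed, of "x + t *\<^sub>R d"] zero by (auto simp: \<gamma>_def)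
  show "(\<gamma> has_vector_derivative d) (at 0)"
    unfolding has_vector_derivative_def has_derivative_at_alt
  proof (intro conjI allI impI bounded_linear_scaleR_left)
    fix e :: real
    assume "e > 0"
    obtain \<delta> where "\<delta> > 0"
      and near: "\<And>t. \<bar>t\<bar> < \<delta> \<Longrightarrow> \<exists>y. c y = 0 \<and> norm (y - (x + t *\<^sub>R d)) \<le> e * \<bar>t\<bar>"
      using zero_near_tangent_line[OF assms \<open>e > 0\<close>] by blast
    have "norm (\<gamma> t - \<gamma> 0 - t *\<^sub>R d) \<le> e * \<bar>t\<bar>" if t: "\<bar>t\<bar> < \<delta>" for t
    proof -
      obtain y where "c y = 0" and y: "norm (y - (x + t *\<^sub>R d)) \<le> e * \<bar>t\<bar>"
        using near[OF t] by blast
      then have "norm (\<gamma> t - (x + t *\<^sub>R d)) \<le> norm (y - (x + t *\<^sub>R d))"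
        using closest_point_le[OF closed, of y "x + t *\<^sub>R d"]
        by (simp add: \<gamma>_def dist_norm norm_minus_commute)
      with y show ?thesis
        by (simp add: start algebra_simps)
    qed
    with \<open>\<delta> > 0\<close>
    show "\<exists>\<delta>>0. \<forall>t. norm (t - 0) < \<delta> \<longrightarrow>
        norm (\<gamma> t - \<gamma> 0 - (t - 0) *\<^sub>R d) \<le> e * norm (t - 0)"
      by auto
  qed
qed

lemma derivative_fixes_tangent_directions:
  fixes c :: "'a::euclidean_space \<Rightarrow> 'b::euclidean_space"
  assumes "continuous_on UNIV c"
    and "(c has_derivative c') (at x)" and "surj c'" and "c x = 0" and "c' d = 0"
    and A: "(A has_derivative A') (at x)"
    and fixed: "\<And>y. c y = 0 \<Longrightarrow> A y = y"
  shows "A' d = d"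
proof -
  obtain \<gamma> :: "real \<Rightarrow> 'a" where \<gamma>: "\<gamma> 0 = x" "(\<gamma> has_vector_derivative d) (at 0)" "\<And>t. c (\<gamma> t) = 0"
    using tangent_curve_in_zero_set[OF assms(1-5)] by blast
  have "(A has_derivative A') (at (\<gamma> 0))"
    using A \<gamma>(1) by simp
  then have "((A \<circ> \<gamma>) has_vector_derivative A' d) (at 0)"
    using diff_chain_at[of \<gamma> "\<lambda>t. t *\<^sub>R d" 0 A A'] \<gamma>(2) has_derivative_linear[OF A]
    by (simp add: has_vector_derivative_def o_def linear_scale)
  moreover have "A \<circ> \<gamma> = \<gamma>"
    using fixed \<gamma>(3) by auto
  ultimately show ?thesis
    using \<gamma>(2) vector_derivative_unique_at by metis
qed

section \<open>Multipliers as orthogonality to a kernel\<close>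

text \<open>
  The component of \<open>v\<close> orthogonal to the range of \<open>transpose J\<close> lies in the kernel of \<open>J\<close>; if \<open>v\<close> is
  orthogonal to that kernel, this component is orthogonal to itself.
\<close>

lemma in_range_transpose_iff:
  fixes J :: "real ^ 'n ^ 'p" and v :: "real ^ 'n"
  shows "(\<exists>l. v = transpose J *v l) \<longleftrightarrow> (\<forall>d. J *v d = 0 \<longrightarrow> v \<bullet> d = 0)"
proof
  assume "\<exists>l. v = transpose J *v l"
  then show "\<forall>d. J *v d = 0 \<longrightarrow> v \<bullet> d = 0"
    by (auto simp: dot_lmul_matrix)
next
  assume perp: "\<forall>d. J *v d = 0 \<longrightarrow> v \<bullet> d = 0"
  let ?R = "range ((*v) (transpose J))"
  have "subspace ?R"
    by (intro linear_subspace_image) auto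
  then have "span ?R = ?R"
    by (simp add: span_eq_iff)
  then obtain y w where y: "y \<in> ?R" and w: "\<And>z. z \<in> ?R \<Longrightarrow> orthogonal w z" and v: "v = y + w"
    using orthogonal_subspace_decomp_exists[of ?R v] by metis
  have "l \<bullet> (J *v w) = 0" for l
    using w[of "transpose J *v l"]
    by (simp add: orthogonal_def inner_commute[of w] dot_lmul_matrix)
  then have "J *v w = 0"
    using inner_eq_zero_iff by blast
  then have "v \<bullet> w = 0"
    using perp by blast
  moreover have "y \<bullet> w = 0"
    using w[OF y] by (simp add: orthogonal_def inner_commute)
  ultimately have "w = 0"
    by (simp add: v inner_add_left)
  with y v show "\<exists>l. v = transpose J *v l"
    by auto
qed

lemma has_derivative_grad:
  assumes "f differentiable (at x)"
  shows "(f has_derivative (\<lambda>d. grad f x \<bullet> d)) (at x)"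
proof -
  let ?f' = "frechet_derivative f (at x)"
  have der: "(f has_derivative ?f') (at x)"
    using assms frechet_derivative_works by blast
  then have "linear ?f'"
    by (rule has_derivative_linear)
  then have "?f' d = grad f x \<bullet> d" for d
    by (subst (1) basis_expansion[of d, symmetric])
      (simp add: grad_def linear_sum linear_scale scalar_mult_eq_scaleR inner_vec_def mult.commute)
  then have "?f' = (\<lambda>d. grad f x \<bullet> d)" ..
  with der show ?thesis
    by simp
qed

lemma has_derivative_tjacobian:
  assumes "c differentiable (at x)"
  shows "(c has_derivative (\<lambda>d. transpose (tjacobian c x) *v d)) (at x)"
  using assms by (simp add: tjacobian_def flip: jacobian_works)

lemma ocp_stationary_iff:
  assumes "c differentiable (at x)"
  shows "ocp_stationary f c x \<longleftrightarrow>
    c x = 0 \<and> (\<forall>d. transpose (tjacobian c x) *v d = 0 \<longrightarrow> grad f x \<bullet> d = 0)"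
proof -
  have "(\<Sum>i\<in>UNIV. l $ i *\<^sub>R grad (\<lambda>y. c y $ i) x) = tjacobian c x *v l" for l
    by (simp add: vec_eq_iff matrix_vector_mult_def tjacobian_nth[OF assms] mult.commute)
  then show ?thesis
    using in_range_transpose_iff[of "grad f x" "transpose (tjacobian c x)"]
    by (simp add: ocp_stationary_def)
qed

section \<open>Stationarity of the penalty function at feasible points\<close>

lemma cdf_stationary_iff:
  assumes f: "f differentiable (at x)" and c: "c differentiable (at x)"
    and A: "A differentiable (at x)"
    and zero: "c x = 0" and fixed: "A x = x"
  shows "cdf_stationary \<beta> f c A x \<longleftrightarrow> (\<forall>d. grad f x \<bullet> (transpose (tjacobian A x) *v d) = 0)"
proof -
  have "((\<lambda>y. f (A y)) has_derivative (\<lambda>d. grad f x \<bullet> (transpose (tjacobian A x) *v d))) (at x)"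
    using diff_chain_at[OF has_derivative_tjacobian[OF A]] has_derivative_grad[OF f] fixed
    by (simp add: o_def)
  moreover have "((\<lambda>y. \<beta> / 2 * (norm (c y))\<^sup>2) has_derivative (\<lambda>d. 0)) (at x)"
    using has_derivative_mult_right[OF
        has_derivative_inner[OF has_derivative_tjacobian[OF c] has_derivative_tjacobian[OF c]], of "\<beta> / 2"]
    by (simp add: power2_norm_eq_inner zero)
  ultimately have "(cdf_objective \<beta> f c A has_derivative
      (\<lambda>d. grad f x \<bullet> (transpose (tjacobian A x) *v d))) (at x)"
    using has_derivative_add by (fastforce simp: cdf_objective_def [abs_def])
  moreover have swap: "grad f x \<bullet> (transpose (tjacobian A x) *v d) = d \<bullet> (tjacobian A x *v grad f x)" for d
    by (simp add: inner_commute[of "grad f x"] dot_lmul_matrix)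
  ultimately have "grad (cdf_objective \<beta> f c A) x = tjacobian A x *v grad f x"
    by (intro grad_eq_gderiv) (simp add: gderiv_def)
  then show ?thesis
    using swap
    by (simp add: cdf_stationary_def vector_eq_rdot) (metis inner_eq_zero_iff inner_zero_right)
qed

theorem proposition3p9:
  fixes f :: "real ^ 'n \<Rightarrow> real"
    and c :: "real ^ 'n \<Rightarrow> real ^ 'p"
    and A :: "real ^ 'n \<Rightarrow> real ^ 'n"
    and \<beta> :: real
  assumes f_diff: "\<forall>x. f differentiable (at x)"
    and c_diff: "\<forall>x. c differentiable (at x)"
    and grad_f_lip: "locally_lipschitz (grad f)"
    and Jc_lip: "locally_lipschitz (tjacobian c)"
    and Jc_rank: "\<forall>x\<in>feasible_set c. rank (tjacobian c x) = CARD('p)"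
    and A_diff: "\<forall>x. A differentiable (at x)"
    and JA_lip: "locally_lipschitz (tjacobian A)"
    and A_id: "\<forall>x\<in>feasible_set c. A x = x"
    and JA_Jc: "\<forall>x\<in>feasible_set c. tjacobian A x ** tjacobian c x = 0"
    and beta_pos: "\<beta> > 0"
  shows "(\<forall>x. ocp_stationary f c x \<longrightarrow> cdf_stationary \<beta> f c A x) \<and>
         (\<forall>x. cdf_stationary \<beta> f c A x \<and> x \<in> feasible_set c \<longrightarrow> ocp_stationary f c x)"
proof (intro conjI allI impI)
  fix x
  assume ocp: "ocp_stationary f c x"
  then have zero: "c x = 0"
    by (simp add: ocp_stationary_def)
  then have "transpose (tjacobian c x) ** transpose (tjacobian A x) = 0"
    using JA_Jc by (simp add: feasible_set_def flip: matrix_transpose_mul)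
      (simp add: transpose_def vec_eq_iff)
  then have "transpose (tjacobian c x) *v (transpose (tjacobian A x) *v d) = 0" for d
    by (metis matrix_vector_mul_assoc matrix_vector_mult_0)
  with ocp zero show "cdf_stationary \<beta> f c A x"
    using f_diff c_diff A_diff A_id
    by (simp add: ocp_stationary_iff cdf_stationary_iff feasible_set_def)
next
  fix x
  assume "cdf_stationary \<beta> f c A x \<and> x \<in> feasible_set c"
  then have cdf: "cdf_stationary \<beta> f c A x" and zero: "c x = 0"
    by (auto simp: feasible_set_def)
  have cont: "continuous_on UNIV c"
    using c_diff by (simp add: continuous_at_imp_continuous_on differentiable_imp_continuous_within)
  have surj: "surj ((*v) (transpose (tjacobian c x)))"
    using Jc_rank zero by (simp only: feasible_set_def mem_Collect_eq rank_transpose flip: full_rank_surjective)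
  have "transpose (tjacobian A x) *v d = d" if "transpose (tjacobian c x) *v d = 0" for d
    using derivative_fixes_tangent_directions[OF cont has_derivative_tjacobian surj zero that
        has_derivative_tjacobian] c_diff A_diff A_id
    by (simp add: feasible_set_def)
  with cdf zero show "ocp_stationary f c x"
    using f_diff c_diff A_diff A_id
    by (simp add: ocp_stationary_iff cdf_stationary_iff feasible_set_def) metis
qed

end
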